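(* Let $j\ge3$ and let $V$ be a complex vector space with $\dim V\ge j$. Then $$\operatorname{Hom}_{GL(V)}(\Lambda^jV,L_j(V))=0.$$ Equivalently, in stable dimension there is no nonzero homogeneous linear natural transformation from the degree-$j$ fermionic sector $\Lambda^j$ to the degree-$j$ free-Lie sector $L_j$.
   Context: $L_j(V)$ is the degree-$j$ homogeneous component of the free Lie algebra on $V$ (inside the tensor algebra $T(V)$), and $\Lambda^jV$ is the $j$-th exterior power. Stable dimension means $\dim V\ge j$. *)

theory Defs
  imports Complex_Main "HOL-Library.Poly_Mapping"
begin

section \<open>Complex vector spaces\<close>

class complex_vector = ab_group_add +
  fixes scaleC :: "complex \<Rightarrow> 'a \<Rightarrow> 'a"  (infixr "*\<^sub>C" 75)
  assumes scaleC_add_right: "a *\<^sub>C (x + y) = a *\<^sub>C x + a *\<^sub>C y"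
    and scaleC_add_left: "(a + b) *\<^sub>C x = a *\<^sub>C x + b *\<^sub>C x"
    and scaleC_scaleC: "a *\<^sub>C (b *\<^sub>C x) = (a * b) *\<^sub>C x"
    and scaleC_one: "1 *\<^sub>C x = x"

global_interpretation cvs: vector_space "scaleC :: complex \<Rightarrow> 'a \<Rightarrow> 'a::complex_vector"
  by unfold_locales (simp_all add: scaleC_add_right scaleC_add_left scaleC_scaleC scaleC_one)

abbreviation clinear :: "('a::complex_vector \<Rightarrow> 'b::complex_vector) \<Rightarrow> bool"
  where "clinear \<equiv> Vector_Spaces.linear scaleC scaleC"

text \<open>Up to isomorphism these instances already cover all complex vector spaces.\<close>

instantiation complex :: complex_vector
begin
definition scaleC_complex :: "complex \<Rightarrow> complex \<Rightarrow> complex"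
  where "scaleC_complex = (*)"
instance by standard (simp_all add: scaleC_complex_def algebra_simps)
end

instantiation poly_mapping :: (type, complex_vector) complex_vector
begin
lift_definition scaleC_poly_mapping :: "complex \<Rightarrow> ('a \<Rightarrow>\<^sub>0 'b) \<Rightarrow> ('a \<Rightarrow>\<^sub>0 'b)"
  is "\<lambda>c p k. c *\<^sub>C p k"
  by (erule rev_finite_subset) auto
instance
  by standard (transfer; simp add: fun_eq_iff scaleC_add_right scaleC_add_left scaleC_scaleC scaleC_one)+
end

text \<open>
  The library's \<open>dim\<close> is \<open>0\<close> on infinite-dimensional spaces, so the inequality
  \<open>dim U \<ge> n\<close> is stated through the cardinality of a basis.
\<close>

definition dim_ge :: "nat \<Rightarrow> 'v::complex_vector set \<Rightarrow> bool" where
  "dim_ge n U \<longleftrightarrow>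
    (\<exists>B. B \<subseteq> U \<and> cvs.independent B \<and> U \<subseteq> cvs.span B \<and> (infinite B \<or> n \<le> card B))"

text \<open>Linear maps from the subspace \<open>A\<close> to the subspace \<open>B\<close>; values off \<open>A\<close> are unconstrained.\<close>

definition linear_between ::
    "'a::complex_vector set \<Rightarrow> 'b::complex_vector set \<Rightarrow> ('a \<Rightarrow> 'b) \<Rightarrow> bool" where
  "linear_between A B F \<longleftrightarrow>
    (\<forall>x\<in>A. F x \<in> B) \<and>
    (\<forall>x\<in>A. \<forall>y\<in>A. F (x + y) = F x + F y) \<and>
    (\<forall>c. \<forall>x\<in>A. F (c *\<^sub>C x) = c *\<^sub>C F x)"


section \<open>Two-sided ideals\<close>

inductive_set ideal_generated :: "'r::ring_1 set \<Rightarrow> 'r set" for S where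
  zero: "0 \<in> ideal_generated S"
| mult: "s \<in> S \<Longrightarrow> x * s * y \<in> ideal_generated S"
| add: "p \<in> ideal_generated S \<Longrightarrow> q \<in> ideal_generated S \<Longrightarrow> p + q \<in> ideal_generated S"

lemma ideal_generated_base: "s \<in> S \<Longrightarrow> s \<in> ideal_generated S"
  using ideal_generated.mult[of s S 1 1] by simp

lemma ideal_generated_mult_left: "p \<in> ideal_generated S \<Longrightarrow> r * p \<in> ideal_generated S"
proof (induction rule: ideal_generated.induct)
  case (mult s x y)
  then show ?case using ideal_generated.mult[of s S "r * x" y] by (simp add: mult.assoc)
qed (auto simp: distrib_left intro: ideal_generated.intros)

lemma ideal_generated_mult_right: "p \<in> ideal_generated S \<Longrightarrow> p * r \<in> ideal_generated S"
proof (induction rule: ideal_generated.induct)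
  case (mult s x y)
  then show ?case using ideal_generated.mult[of s S x "y * r"] by (simp add: mult.assoc)
qed (auto simp: distrib_right intro: ideal_generated.intros)

lemma ideal_generated_uminus: "p \<in> ideal_generated S \<Longrightarrow> - p \<in> ideal_generated S"
  using ideal_generated_mult_left[of p S "- 1"] by simp

lemma ideal_generated_diff:
  "p \<in> ideal_generated S \<Longrightarrow> q \<in> ideal_generated S \<Longrightarrow> p - q \<in> ideal_generated S"
  using ideal_generated.add[of p S "- q"] ideal_generated_uminus[of q S] by simp

lemma ideal_generated_times_cong:
  assumes "p - p' \<in> ideal_generated S" "q - q' \<in> ideal_generated S"
  shows "p * q - p' * q' \<in> ideal_generated S"
proof -
  have "p * q - p' * q' = (p - p') * q + p' * (q - q')"
    by (simp add: algebra_simps)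
  then show ?thesis
    using assms by (simp add: ideal_generated.add ideal_generated_mult_left ideal_generated_mult_right)
qed

lemma ideal_generated_add_cong:
  assumes "p - p' \<in> ideal_generated S" "q - q' \<in> ideal_generated S"
  shows "(p + q) - (p' + q') \<in> ideal_generated S"
  using ideal_generated.add[OF assms] by (simp add: algebra_simps)

lemma ideal_generated_minus_cong:
  assumes "p - p' \<in> ideal_generated S" "q - q' \<in> ideal_generated S"
  shows "(p - q) - (p' - q') \<in> ideal_generated S"
  using ideal_generated_diff[OF assms] by (simp add: algebra_simps)

lemma ideal_generated_uminus_cong:
  assumes "p - p' \<in> ideal_generated S"
  shows "(- p) - (- p') \<in> ideal_generated S"
  using ideal_generated_uminus[OF assms] by (simp add: algebra_simps)

lemma equivp_mod_ideal: "equivp (\<lambda>p q. p - q \<in> ideal_generated S)"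
proof (rule equivpI)
  show "reflp (\<lambda>p q. p - q \<in> ideal_generated S)"
    by (simp add: reflp_def ideal_generated.zero)
  show "symp (\<lambda>p q. p - q \<in> ideal_generated S)"
    unfolding symp_def by (metis ideal_generated_uminus minus_diff_eq)
  show "transp (\<lambda>p q. p - q \<in> ideal_generated S)"
    unfolding transp_def using ideal_generated.add by fastforce
qed


section \<open>The tensor algebra\<close>

text \<open>
  \<open>T(V)\<close> is the free unital associative algebra on the underlying set of \<open>V\<close> (the monoid algebra
  of the free monoid on \<open>V\<close>), modulo the relations making the canonical map from \<open>V\<close> linear.
\<close>

datatype 'a free_monoid = Word "'a list"

instantiation free_monoid :: (type) monoid_add
begin

definition zero_free_monoid :: "'a free_monoid"
  where "0 = Word []"

fun plus_free_monoid :: "'a free_monoid \<Rightarrow> 'a free_monoid \<Rightarrow> 'a free_monoid"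
  where "Word u + Word v = Word (u @ v)"

instance
proof
  fix a b c :: "'a free_monoid"
  show "a + b + c = a + (b + c)" by (cases a; cases b; cases c) simp
  show "0 + a = a" by (cases a) (simp add: zero_free_monoid_def)
  show "a + 0 = a" by (cases a) (simp add: zero_free_monoid_def)
qed

end

type_synonym 'v free_algebra = "'v free_monoid \<Rightarrow>\<^sub>0 complex"

definition free_gen :: "'v \<Rightarrow> 'v free_algebra"
  where "free_gen v = Poly_Mapping.single (Word [v]) 1"

definition free_const :: "complex \<Rightarrow> 'v free_algebra"
  where "free_const c = Poly_Mapping.single 0 c"

definition linearity_relations :: "'v::complex_vector free_algebra set" where
  "linearity_relations =
    {free_gen (u + v) - (free_gen u + free_gen v) | u v. True} \<union>
    {free_gen (c *\<^sub>C v) - free_const c * free_gen v | c v. True}"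

lemma free_const_add: "free_const (c + d) = free_const c + free_const d"
  by (simp add: free_const_def single_add)

lemma free_const_mult: "free_const (c * d) = free_const c * free_const d"
  by (simp add: free_const_def mult_single)

lemma free_const_one: "free_const 1 = 1"
  by (simp add: free_const_def)

lemma poly_mapping_sum_single:
  "p = (\<Sum>k\<in>Poly_Mapping.keys p. Poly_Mapping.single k (Poly_Mapping.lookup p k))"
  by (rule poly_mapping_eqI)
     (simp add: lookup_sum lookup_single when_def sum.delta' in_keys_iff cong: if_cong)

lemma free_const_central:
  fixes p :: "'v free_algebra"
  shows "free_const c * p = p * free_const c"
proof -
  have "free_const c * Poly_Mapping.single k a = Poly_Mapping.single k a * free_const c"
    for k :: "'v free_monoid" and a
    by (simp add: free_const_def mult_single mult.commute)
  then show ?thesis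
    by (subst (1 2) poly_mapping_sum_single[of p]) (simp only: sum_distrib_left sum_distrib_right)
qed

lemma free_const_left_commute: "p * (free_const c * q) = free_const c * (p * q)"
  by (subst (1 2) mult.assoc[symmetric]) (rule arg_cong2[OF free_const_central[symmetric] refl])

text \<open>Additive and multiplicative extension of a map given on monomials \<open>a \<cdot> k\<close>.\<close>

definition monomial_extend :: "('k \<Rightarrow> 'a \<Rightarrow> 'b) \<Rightarrow> ('k \<Rightarrow>\<^sub>0 'a::zero) \<Rightarrow> 'b::comm_monoid_add"
  where "monomial_extend h p = (\<Sum>k\<in>Poly_Mapping.keys p. h k (Poly_Mapping.lookup p k))"

lemma monomial_extend_zero [simp]: "monomial_extend h 0 = 0"
  by (simp add: monomial_extend_def)

lemma monomial_extend_single: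
  assumes "\<And>k. h k 0 = 0"
  shows "monomial_extend h (Poly_Mapping.single k a) = h k a"
  using assms by (simp add: monomial_extend_def)

lemma monomial_extend_add:
  fixes h :: "'k \<Rightarrow> 'a::comm_monoid_add \<Rightarrow> 'b::comm_monoid_add"
  assumes "\<And>k. h k 0 = 0" "\<And>k a b. h k (a + b) = h k a + h k b"
  shows "monomial_extend h (p + q) = monomial_extend h p + monomial_extend h q"
  unfolding monomial_extend_def by (rule setsum_keys_plus_distrib) (use assms in auto)

lemma monomial_extend_sum:
  fixes h :: "'k \<Rightarrow> 'a::comm_monoid_add \<Rightarrow> 'b::comm_monoid_add"
  assumes "\<And>k. h k 0 = 0" "\<And>k a b. h k (a + b) = h k a + h k b"
  shows "monomial_extend h (sum p I) = (\<Sum>i\<in>I. monomial_extend h (p i))"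
  by (induction I rule: infinite_finite_induct) (simp_all add: monomial_extend_add[OF assms])

lemma monomial_extend_mult:
  fixes h :: "'k::monoid_add \<Rightarrow> 'a::semiring_0 \<Rightarrow> 'b::semiring_0"
  assumes h0: "\<And>k. h k 0 = 0" and ha: "\<And>k a b. h k (a + b) = h k a + h k b"
    and hm: "\<And>k l a b. h (k + l) (a * b) = h k a * h l b"
  shows "monomial_extend h (p * q) = monomial_extend h p * monomial_extend h q"
proof -
  have "p * q = (\<Sum>k\<in>Poly_Mapping.keys p. \<Sum>l\<in>Poly_Mapping.keys q.
      Poly_Mapping.single (k + l) (Poly_Mapping.lookup p k * Poly_Mapping.lookup q l))"
    by (subst (1) poly_mapping_sum_single[of p], subst (1) poly_mapping_sum_single[of q])
      (simp add: sum_product mult_single)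
  then show ?thesis
    by (simp add: monomial_extend_sum[of h, OF h0 ha] monomial_extend_single[of h, OF h0] hm)
      (simp add: monomial_extend_def sum_product)
qed

lemma monomial_extend_diff:
  fixes h :: "'k \<Rightarrow> 'a::ab_group_add \<Rightarrow> 'b::ab_group_add"
  assumes "\<And>k. h k 0 = 0" "\<And>k a b. h k (a + b) = h k a + h k b"
  shows "monomial_extend h (p - q) = monomial_extend h p - monomial_extend h q"
  using monomial_extend_add[of h "p - q" q] assms by simp

lemma ideal_generated_image:
  assumes add: "\<And>p q. f (p + q) = f p + f q" and mult: "\<And>p q. f (p * q) = f p * f q"
    and gen: "\<And>s. s \<in> S \<Longrightarrow> f s \<in> ideal_generated T"
    and p: "p \<in> ideal_generated S"
  shows "f p \<in> ideal_generated T"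
  using p
proof (induction rule: ideal_generated.induct)
  case zero
  have "f 0 = 0" using add[of 0 0] by simp
  then show ?case by (simp add: ideal_generated.zero)
qed (simp_all add: add mult gen ideal_generated.add ideal_generated_mult_left
      ideal_generated_mult_right)

lemma ideal_generated_empty: "p \<in> ideal_generated {} \<Longrightarrow> p = 0"
  by (induction rule: ideal_generated.induct) simp_all

text \<open>The constant coefficient, which is a homomorphism; it shows that the quotients are nonzero.\<close>

abbreviation free_augmentation :: "'v free_algebra \<Rightarrow> complex"
  where "free_augmentation \<equiv> monomial_extend (\<lambda>k a. if k = 0 then a else 0)"

lemma free_monoid_add_eq_0_iff [simp]: "k + l = 0 \<longleftrightarrow> k = 0 \<and> l = (0 :: 'a free_monoid)"
  by (cases k; cases l) (auto simp: zero_free_monoid_def)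

lemma free_augmentation_add: "free_augmentation (p + q) = free_augmentation p + free_augmentation q"
  by (rule monomial_extend_add) auto

lemma free_augmentation_diff: "free_augmentation (p - q) = free_augmentation p - free_augmentation q"
  by (rule monomial_extend_diff) auto

lemma free_augmentation_mult: "free_augmentation (p * q) = free_augmentation p * free_augmentation q"
  by (rule monomial_extend_mult) auto

lemma free_augmentation_single:
  "free_augmentation (Poly_Mapping.single k a) = (if k = 0 then a else 0)"
  by (rule monomial_extend_single) simp

lemma free_augmentation_gen: "free_augmentation (free_gen v) = 0"
  unfolding free_gen_def free_augmentation_single by (simp add: zero_free_monoid_def)

lemma free_augmentation_relations:
  assumes "p \<in> ideal_generated linearity_relations"
  shows "free_augmentation p = 0"
proof -
  have "free_augmentation p \<in> ideal_generated {}"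
    by (rule ideal_generated_image[OF _ _ _ assms])
      (auto simp: free_augmentation_add free_augmentation_mult free_augmentation_diff
        linearity_relations_def free_augmentation_gen ideal_generated.zero)
  then show ?thesis by (rule ideal_generated_empty)
qed

quotient_type (overloaded) 'v tensor = "'v::complex_vector free_algebra" /
  "\<lambda>p q. p - q \<in> ideal_generated linearity_relations"
  by (rule equivp_mod_ideal)

instantiation tensor :: (complex_vector) ring_1
begin

lift_definition zero_tensor :: "'a tensor" is 0 .
lift_definition one_tensor :: "'a tensor" is 1 .
lift_definition plus_tensor :: "'a tensor \<Rightarrow> 'a tensor \<Rightarrow> 'a tensor" is "(+)"
  by (rule ideal_generated_add_cong)
lift_definition minus_tensor :: "'a tensor \<Rightarrow> 'a tensor \<Rightarrow> 'a tensor" is "(-)"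
  by (rule ideal_generated_minus_cong)
lift_definition uminus_tensor :: "'a tensor \<Rightarrow> 'a tensor" is uminus
  by (rule ideal_generated_uminus_cong)
lift_definition times_tensor :: "'a tensor \<Rightarrow> 'a tensor \<Rightarrow> 'a tensor" is "(*)"
  by (rule ideal_generated_times_cong)

instance
proof
  fix a b c :: "'a tensor"
  show "a + b + c = a + (b + c)"
    by transfer (simp add: add.assoc ideal_generated.zero)
  show "a + b = b + a"
    by transfer (simp add: add.commute ideal_generated.zero)
  show "0 + a = a"
    by transfer (simp add: ideal_generated.zero)
  show "- a + a = 0"
    by transfer (simp add: ideal_generated.zero)
  show "a - b = a + - b"
    by transfer (simp add: ideal_generated.zero)
  show "a * b * c = a * (b * c)"
    by transfer (simp add: mult.assoc ideal_generated.zero)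
  show "1 * a = a"
    by transfer (simp add: ideal_generated.zero)
  show "a * 1 = a"
    by transfer (simp add: ideal_generated.zero)
  show "(a + b) * c = a * c + b * c"
    by transfer (simp add: distrib_right ideal_generated.zero)
  show "a * (b + c) = a * b + a * c"
    by transfer (simp add: distrib_left ideal_generated.zero)
  show "(0 :: 'a tensor) \<noteq> 1"
  proof
    assume "(0 :: 'a tensor) = 1"
    then have "(0 - 1 :: 'a free_algebra) \<in> ideal_generated linearity_relations"
      by transfer
    then have "free_augmentation (0 - 1 :: 'a free_algebra) = 0"
      by (rule free_augmentation_relations)
    then show False
      by (simp only: free_augmentation_diff single_one[symmetric] free_augmentation_single) simp
  qed
qed

end

instantiation tensor :: (complex_vector) complex_vector
begin

lift_definition scaleC_tensor :: "complex \<Rightarrow> 'a tensor \<Rightarrow> 'a tensor"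
  is "\<lambda>c p. free_const c * p"
  by (metis ideal_generated_mult_left right_diff_distrib)

instance
proof
  fix c d :: complex and x y :: "'a tensor"
  show "c *\<^sub>C (x + y) = c *\<^sub>C x + c *\<^sub>C y"
    by transfer (simp add: distrib_left ideal_generated.zero)
  show "(c + d) *\<^sub>C x = c *\<^sub>C x + d *\<^sub>C x"
    by transfer (simp add: free_const_add distrib_right ideal_generated.zero)
  show "c *\<^sub>C d *\<^sub>C x = (c * d) *\<^sub>C x"
    by transfer (simp add: free_const_mult mult.assoc ideal_generated.zero)
  show "1 *\<^sub>C x = x"
    by transfer (simp add: free_const_one ideal_generated.zero)
qed

end

lift_definition tensor_of :: "'v::complex_vector \<Rightarrow> 'v tensor" is free_gen .

lemma scaleC_tensor_mult_left: "(c *\<^sub>C s) * t = c *\<^sub>C (s * t)" for s t :: "'v::complex_vector tensor"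
  by transfer (simp add: mult.assoc ideal_generated.zero)

lemma scaleC_tensor_mult_right: "s * (c *\<^sub>C t) = c *\<^sub>C (s * t)" for s t :: "'v::complex_vector tensor"
  by transfer (simp add: free_const_left_commute ideal_generated.zero)

lemma tensor_of_add: "tensor_of (u + v) = tensor_of u + tensor_of v"
  by transfer (rule ideal_generated_base, auto simp: linearity_relations_def)

lemma tensor_of_scaleC: "tensor_of (c *\<^sub>C v) = c *\<^sub>C tensor_of v"
  by transfer (rule ideal_generated_base, auto simp: linearity_relations_def)

text \<open>
  For a subspace \<open>U\<close>, the space \<open>T\<^sup>j(U)\<close> is spanned by the products of \<open>j\<close> vectors of \<open>U\<close>;
  over a field, the tensor algebra of \<open>U\<close> is the subalgebra generated by \<open>U\<close>.
\<close>

definition tensor_power :: "nat \<Rightarrow> 'v::complex_vector set \<Rightarrow> 'v tensor set" where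
  "tensor_power j U = cvs.span {prod_list (map tensor_of vs) | vs. length vs = j \<and> set vs \<subseteq> U}"

text \<open>
  The algebra map \<open>T(f)\<close> induced by a linear map \<open>f\<close>, sending \<open>v\<^sub>1 \<otimes> \<dots> \<otimes> v\<^sub>k\<close> to
  \<open>f v\<^sub>1 \<otimes> \<dots> \<otimes> f v\<^sub>k\<close>. It is computed on an arbitrary representative, so it is meaningful only
  for linear \<open>f\<close>.
\<close>

definition free_algebra_map :: "('v \<Rightarrow> 'w) \<Rightarrow> 'v free_algebra \<Rightarrow> 'w free_algebra" where
  "free_algebra_map f = monomial_extend (\<lambda>k a. Poly_Mapping.single (map_free_monoid f k) a)"

definition tensor_map ::
    "('v::complex_vector \<Rightarrow> 'w::complex_vector) \<Rightarrow> 'v tensor \<Rightarrow> 'w tensor" where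
  "tensor_map f t = abs_tensor (free_algebra_map f (rep_tensor t))"

lemma map_free_monoid_add: "map_free_monoid f (k + l) = map_free_monoid f k + map_free_monoid f l"
  by (cases k; cases l) simp

lemma free_algebra_map_add: "free_algebra_map f (p + q) = free_algebra_map f p + free_algebra_map f q"
  unfolding free_algebra_map_def by (rule monomial_extend_add) (simp_all add: single_add)

lemma free_algebra_map_diff: "free_algebra_map f (p - q) = free_algebra_map f p - free_algebra_map f q"
  unfolding free_algebra_map_def by (rule monomial_extend_diff) (simp_all add: single_add)

lemma free_algebra_map_mult: "free_algebra_map f (p * q) = free_algebra_map f p * free_algebra_map f q"
  unfolding free_algebra_map_def
  by (rule monomial_extend_mult) (simp_all add: single_add mult_single map_free_monoid_add)

lemma free_algebra_map_single:
  "free_algebra_map f (Poly_Mapping.single k a) = Poly_Mapping.single (map_free_monoid f k) a"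
  unfolding free_algebra_map_def by (rule monomial_extend_single) simp

lemma free_algebra_map_gen: "free_algebra_map f (free_gen v) = free_gen (f v)"
  by (simp add: free_gen_def free_algebra_map_single)

lemma free_algebra_map_const: "free_algebra_map f (free_const c) = free_const c"
  by (simp add: free_const_def free_algebra_map_single zero_free_monoid_def)

lemma free_algebra_map_relations:
  fixes f :: "'v::complex_vector \<Rightarrow> 'w::complex_vector"
  assumes f: "clinear f" and p: "p \<in> ideal_generated linearity_relations"
  shows "free_algebra_map f p \<in> ideal_generated linearity_relations"
proof (rule ideal_generated_image[OF _ _ _ p])
  interpret f: Vector_Spaces.linear scaleC scaleC f by (rule f)
  fix s :: "'v free_algebra" assume "s \<in> linearity_relations"
  then consider (add) u v where "s = free_gen (u + v) - (free_gen u + free_gen v)"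
    | (scale) c v where "s = free_gen (c *\<^sub>C v) - free_const c * free_gen v"
    unfolding linearity_relations_def by blast
  then have "free_algebra_map f s \<in> linearity_relations"
  proof cases
    case add
    then have "free_algebra_map f s = free_gen (f u + f v) - (free_gen (f u) + free_gen (f v))"
      by (simp add: free_algebra_map_diff free_algebra_map_add free_algebra_map_gen f.add)
    then show ?thesis unfolding linearity_relations_def by blast
  next
    case scale
    then have "free_algebra_map f s = free_gen (c *\<^sub>C f v) - free_const c * free_gen (f v)"
      by (simp add: free_algebra_map_diff free_algebra_map_mult free_algebra_map_gen
          free_algebra_map_const f.scale)
    then show ?thesis unfolding linearity_relations_def by blast
  qed
  then show "free_algebra_map f s \<in> ideal_generated linearity_relations"
    by (rule ideal_generated_base)
qed (rule free_algebra_map_add free_algebra_map_mult)+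

lemma tensor_map_abs:
  assumes f: "clinear f"
  shows "tensor_map f (abs_tensor p) = abs_tensor (free_algebra_map f p)"
proof -
  have "rep_tensor (abs_tensor p) - p \<in> ideal_generated linearity_relations"
    using Quotient3_rep_abs[OF Quotient3_tensor] equivp_reflp[OF tensor_equivp] by fast
  from free_algebra_map_relations[OF f this] show ?thesis
    unfolding tensor_map_def tensor.abs_eq_iff free_algebra_map_diff .
qed

lemma tensor_map_of: "clinear f \<Longrightarrow> tensor_map f (tensor_of v) = tensor_of (f v)"
  by (simp add: tensor_of.abs_eq tensor_map_abs free_algebra_map_gen)

lemma tensor_map_one: "clinear f \<Longrightarrow> tensor_map f 1 = 1"
  using free_algebra_map_const[of f 1] by (simp add: one_tensor.abs_eq tensor_map_abs free_const_one)

lemma tensor_map_add: "clinear f \<Longrightarrow> tensor_map f (s + t) = tensor_map f s + tensor_map f t"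
  by (induction s rule: tensor.abs_induct, induction t rule: tensor.abs_induct)
    (simp add: plus_tensor.abs_eq tensor_map_abs free_algebra_map_add)

lemma tensor_map_mult: "clinear f \<Longrightarrow> tensor_map f (s * t) = tensor_map f s * tensor_map f t"
  by (induction s rule: tensor.abs_induct, induction t rule: tensor.abs_induct)
    (simp add: times_tensor.abs_eq tensor_map_abs free_algebra_map_mult)

lemma tensor_map_scaleC: "clinear f \<Longrightarrow> tensor_map f (c *\<^sub>C t) = c *\<^sub>C tensor_map f t"
  by (induction t rule: tensor.abs_induct)
    (simp add: scaleC_tensor.abs_eq tensor_map_abs free_algebra_map_mult free_algebra_map_const)

lemma tensor_map_diff: "clinear f \<Longrightarrow> tensor_map f (s - t) = tensor_map f s - tensor_map f t"
  using tensor_map_add[of f "s - t" t] by simp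


section \<open>The free Lie algebra\<close>

inductive_set free_lie :: "'v::complex_vector set \<Rightarrow> 'v tensor set" for U where
  gen: "v \<in> U \<Longrightarrow> tensor_of v \<in> free_lie U"
| zero: "0 \<in> free_lie U"
| add: "x \<in> free_lie U \<Longrightarrow> y \<in> free_lie U \<Longrightarrow> x + y \<in> free_lie U"
| scale: "x \<in> free_lie U \<Longrightarrow> c *\<^sub>C x \<in> free_lie U"
| bracket: "x \<in> free_lie U \<Longrightarrow> y \<in> free_lie U \<Longrightarrow> x * y - y * x \<in> free_lie U"

definition free_lie_part :: "nat \<Rightarrow> 'v::complex_vector set \<Rightarrow> 'v tensor set"
  where "free_lie_part j U = free_lie U \<inter> tensor_power j U"


section \<open>The exterior algebra\<close>

lift_definition augmentation :: "'v::complex_vector tensor \<Rightarrow> complex" is free_augmentation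
  by (metis free_augmentation_diff free_augmentation_relations right_minus_eq)

lemma augmentation_add: "augmentation (s + t) = augmentation s + augmentation t"
  by transfer (rule free_augmentation_add)

lemma augmentation_mult: "augmentation (s * t) = augmentation s * augmentation t"
  by transfer (rule free_augmentation_mult)

lemma augmentation_of: "augmentation (tensor_of v) = 0"
  by transfer (rule free_augmentation_gen)

lemma augmentation_one: "augmentation 1 = 1"
  by transfer (simp only: single_one[symmetric] free_augmentation_single, simp)

definition alternating_relations :: "'v::complex_vector tensor set"
  where "alternating_relations = {tensor_of v * tensor_of v | v. True}"

lemma augmentation_alternating:
  assumes "t \<in> ideal_generated alternating_relations"
  shows "augmentation t = 0"
proof -
  have "augmentation t \<in> ideal_generated {}"
    by (rule ideal_generated_image[OF _ _ _ assms])
      (auto simp: augmentation_add augmentation_mult alternating_relations_def augmentation_of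
        ideal_generated.zero)
  then show ?thesis by (rule ideal_generated_empty)
qed

quotient_type (overloaded) 'v exterior = "'v::complex_vector tensor" /
  "\<lambda>s t. s - t \<in> ideal_generated alternating_relations"
  by (rule equivp_mod_ideal)

instantiation exterior :: (complex_vector) ring_1
begin

lift_definition zero_exterior :: "'a exterior" is 0 .
lift_definition one_exterior :: "'a exterior" is 1 .
lift_definition plus_exterior :: "'a exterior \<Rightarrow> 'a exterior \<Rightarrow> 'a exterior" is "(+)"
  by (rule ideal_generated_add_cong)
lift_definition minus_exterior :: "'a exterior \<Rightarrow> 'a exterior \<Rightarrow> 'a exterior" is "(-)"
  by (rule ideal_generated_minus_cong)
lift_definition uminus_exterior :: "'a exterior \<Rightarrow> 'a exterior" is uminus
  by (rule ideal_generated_uminus_cong)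
lift_definition times_exterior :: "'a exterior \<Rightarrow> 'a exterior \<Rightarrow> 'a exterior" is "(*)"
  by (rule ideal_generated_times_cong)

instance
proof
  fix a b c :: "'a exterior"
  show "a + b + c = a + (b + c)"
    by transfer (simp add: add.assoc ideal_generated.zero)
  show "a + b = b + a"
    by transfer (simp add: add.commute ideal_generated.zero)
  show "0 + a = a"
    by transfer (simp add: ideal_generated.zero)
  show "- a + a = 0"
    by transfer (simp add: ideal_generated.zero)
  show "a - b = a + - b"
    by transfer (simp add: ideal_generated.zero)
  show "a * b * c = a * (b * c)"
    by transfer (simp add: mult.assoc ideal_generated.zero)
  show "1 * a = a"
    by transfer (simp add: ideal_generated.zero)
  show "a * 1 = a"
    by transfer (simp add: ideal_generated.zero)
  show "(a + b) * c = a * c + b * c"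
    by transfer (simp add: distrib_right ideal_generated.zero)
  show "a * (b + c) = a * b + a * c"
    by transfer (simp add: distrib_left ideal_generated.zero)
  show "(0 :: 'a exterior) \<noteq> 1"
  proof
    assume "(0 :: 'a exterior) = 1"
    then have "(0 - 1 :: 'a tensor) \<in> ideal_generated alternating_relations"
      by transfer
    then have "augmentation (0 - 1 :: 'a tensor) = 0"
      by (rule augmentation_alternating)
    then show False
      using augmentation_add[of "0 - 1" "1 :: 'a tensor"] augmentation_add[of 0 "0 :: 'a tensor"]
      by (simp add: augmentation_one)
  qed
qed

end

instantiation exterior :: (complex_vector) complex_vector
begin

lift_definition scaleC_exterior :: "complex \<Rightarrow> 'a exterior \<Rightarrow> 'a exterior" is scaleC
proof -
  fix c :: complex and s t :: "'a tensor"
  assume "s - t \<in> ideal_generated alternating_relations"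
  then have "(c *\<^sub>C 1) * (s - t) \<in> ideal_generated alternating_relations"
    by (rule ideal_generated_mult_left)
  then show "c *\<^sub>C s - c *\<^sub>C t \<in> ideal_generated alternating_relations"
    by (simp add: scaleC_tensor_mult_left cvs.scale_right_diff_distrib)
qed

instance
proof
  fix c d :: complex and x y :: "'a exterior"
  show "c *\<^sub>C (x + y) = c *\<^sub>C x + c *\<^sub>C y"
    by transfer (simp add: scaleC_add_right ideal_generated.zero)
  show "(c + d) *\<^sub>C x = c *\<^sub>C x + d *\<^sub>C x"
    by transfer (simp add: scaleC_add_left ideal_generated.zero)
  show "c *\<^sub>C d *\<^sub>C x = (c * d) *\<^sub>C x"
    by transfer (simp add: scaleC_scaleC ideal_generated.zero)
  show "1 *\<^sub>C x = x"
    by transfer (simp add: scaleC_one ideal_generated.zero)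
qed

end

lift_definition exterior_of :: "'v::complex_vector \<Rightarrow> 'v exterior" is tensor_of .

lemma exterior_of_square: "exterior_of v * exterior_of v = 0"
  by transfer (rule ideal_generated_base, auto simp: alternating_relations_def)

text \<open>As for \<^const>\<open>tensor_power\<close>, \<open>\<Lambda>(U)\<close> is identified with the subalgebra generated by the subspace \<open>U\<close>.\<close>

definition exterior_power :: "nat \<Rightarrow> 'v::complex_vector set \<Rightarrow> 'v exterior set" where
  "exterior_power j U = cvs.span {prod_list (map exterior_of vs) | vs. length vs = j \<and> set vs \<subseteq> U}"

text \<open>The algebra map induced by a linear map; as for \<^const>\<open>tensor_map\<close>, only meaningful for linear maps.\<close>

definition exterior_map ::
    "('v::complex_vector \<Rightarrow> 'w::complex_vector) \<Rightarrow> 'v exterior \<Rightarrow> 'w exterior" where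
  "exterior_map f x = abs_exterior (tensor_map f (rep_exterior x))"

lemma tensor_map_alternating:
  fixes f :: "'v::complex_vector \<Rightarrow> 'w::complex_vector"
  assumes f: "clinear f" and t: "t \<in> ideal_generated alternating_relations"
  shows "tensor_map f t \<in> ideal_generated alternating_relations"
proof (rule ideal_generated_image[OF _ _ _ t])
  fix s :: "'v tensor" assume "s \<in> alternating_relations"
  then have "tensor_map f s \<in> alternating_relations"
    by (auto simp: alternating_relations_def tensor_map_mult[OF f] tensor_map_of[OF f])
  then show "tensor_map f s \<in> ideal_generated alternating_relations"
    by (rule ideal_generated_base)
qed (rule tensor_map_add[OF f] tensor_map_mult[OF f])+

lemma exterior_map_abs:
  assumes f: "clinear f"
  shows "exterior_map f (abs_exterior t) = abs_exterior (tensor_map f t)"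
proof -
  have "rep_exterior (abs_exterior t) - t \<in> ideal_generated alternating_relations"
    using Quotient3_rep_abs[OF Quotient3_exterior] equivp_reflp[OF exterior_equivp] by fast
  from tensor_map_alternating[OF f this] show ?thesis
    unfolding exterior_map_def exterior.abs_eq_iff tensor_map_diff[OF f] .
qed

lemma exterior_map_of: "clinear f \<Longrightarrow> exterior_map f (exterior_of v) = exterior_of (f v)"
  by (simp add: exterior_of.abs_eq exterior_map_abs tensor_map_of)

lemma exterior_map_one: "clinear f \<Longrightarrow> exterior_map f 1 = 1"
  by (simp add: one_exterior.abs_eq exterior_map_abs tensor_map_one)

lemma exterior_map_add: "clinear f \<Longrightarrow> exterior_map f (x + y) = exterior_map f x + exterior_map f y"
  by (induction x rule: exterior.abs_induct, induction y rule: exterior.abs_induct)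
    (simp add: plus_exterior.abs_eq exterior_map_abs tensor_map_add)

lemma exterior_map_mult: "clinear f \<Longrightarrow> exterior_map f (x * y) = exterior_map f x * exterior_map f y"
  by (induction x rule: exterior.abs_induct, induction y rule: exterior.abs_induct)
    (simp add: times_exterior.abs_eq exterior_map_abs tensor_map_mult)

lemma exterior_map_scaleC: "clinear f \<Longrightarrow> exterior_map f (c *\<^sub>C x) = c *\<^sub>C exterior_map f x"
  by (induction x rule: exterior.abs_induct)
    (simp add: scaleC_exterior.abs_eq exterior_map_abs tensor_map_scaleC)


section \<open>Equivariant maps and natural transformations\<close>

definition GL :: "('v::complex_vector \<Rightarrow> 'v) set"
  where "GL = {g. clinear g \<and> bij g}"

text \<open>
  \<open>Hom\<^bsub>GL(V)\<^esub>(\<Lambda>\<^sup>j V, L\<^sub>j(V))\<close> for \<open>V\<close> the whole type. A map defined on \<open>\<Lambda>\<^sup>j V\<close> is represented by its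
  extension by zero, so that each homomorphism has exactly one representative.
\<close>

definition Hom_GL :: "nat \<Rightarrow> ('v::complex_vector exterior \<Rightarrow> 'v tensor) set" where
  "Hom_GL j =
    {F. linear_between (exterior_power j UNIV) (free_lie_part j UNIV) F \<and>
        (\<forall>g\<in>GL. \<forall>x\<in>exterior_power j UNIV. F (exterior_map g x) = tensor_map g (F x)) \<and>
        (\<forall>x. x \<notin> exterior_power j UNIV \<longrightarrow> F x = 0)}"

text \<open>
  Objects of the category on which \<open>\<Lambda>\<^sup>j\<close> and \<open>L\<^sub>j\<close> are compared: the subspaces of dimension at
  least \<open>j\<close> of an ambient space. The type of the ambient space is a variable and plays the role of
  the universe (every set of vector spaces embeds into a common one).
\<close>

definition stable_spaces :: "nat \<Rightarrow> 'u::complex_vector set set"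
  where "stable_spaces j = {U. cvs.subspace U \<and> dim_ge j U}"

text \<open>
  Linear natural transformations \<open>\<eta>\<^sub>U : \<Lambda>\<^sup>j U \<rightarrow> L\<^sub>j(U)\<close>, for all linear maps \<open>U \<rightarrow> W\<close> between objects. Every linear
  map \<open>U \<rightarrow> W\<close> is the restriction of a linear map \<open>f\<close> of the ambient space with \<open>f ` U \<subseteq> W\<close>, and the
  maps it induces on \<open>\<Lambda>\<^sup>j U\<close> and \<open>L\<^sub>j(U)\<close> are restrictions of those induced by \<open>f\<close>.
\<close>

definition natural_transformation ::
    "nat \<Rightarrow> ('u::complex_vector set \<Rightarrow> 'u exterior \<Rightarrow> 'u tensor) \<Rightarrow> bool" where
  "natural_transformation j \<eta> \<longleftrightarrow>
    (\<forall>U\<in>stable_spaces j. linear_between (exterior_power j U) (free_lie_part j U) (\<eta> U)) \<and>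
    (\<forall>U\<in>stable_spaces j. \<forall>W\<in>stable_spaces j. \<forall>f. clinear f \<longrightarrow> f ` U \<subseteq> W \<longrightarrow>
      (\<forall>x\<in>exterior_power j U. \<eta> W (exterior_map f x) = tensor_map f (\<eta> U x)))"

definition nonzero_transformation ::
    "nat \<Rightarrow> ('u::complex_vector set \<Rightarrow> 'u exterior \<Rightarrow> 'u tensor) \<Rightarrow> bool" where
  "nonzero_transformation j \<eta> \<longleftrightarrow> (\<exists>U\<in>stable_spaces j. \<exists>x\<in>exterior_power j U. \<eta> U x \<noteq> 0)"

end

theory Submission
  imports Defs "HOL-Combinatorics.Permutations"
begin

text \<open>
  Let \<open>v\<^sub>1, \<dots>, v\<^sub>j\<close> be distinct members of a basis, \<open>w = v\<^sub>1 \<and> \<dots> \<and> v\<^sub>j\<close>, and \<open>m = F w\<close> for an equivariant \<open>F\<close>.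
  Equivariance determines \<open>m\<close> up to a scalar. Scaling one \<open>v\<^sub>i\<close> by \<open>2\<close> doubles \<open>w\<close>, hence doubles \<open>m\<close>; so
  \<open>m\<close> is a combination of words in which each \<open>v\<^sub>i\<close> occurs exactly once, that is, of rearrangements
  of \<open>v\<^sub>1 \<otimes> \<dots> \<otimes> v\<^sub>j\<close> (\<open>tensor_weight_space\<close>). Permuting the \<open>v\<^sub>i\<close> multiplies \<open>w\<close>, hence \<open>m\<close>, by the sign;
  averaging over all permutations shows that \<open>j! m = c a\<close>, where \<open>a\<close> is the antisymmetrisation of
  \<open>v\<^sub>1 \<otimes> \<dots> \<otimes> v\<^sub>j\<close>, and with the same scalar \<open>c\<close> the projection \<open>\<pi> : T(V) \<rightarrow> \<Lambda>(V)\<close> sends \<open>m\<close> to \<open>c w\<close>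
  (\<open>alternating_combination_of_permuted_words\<close>).

  On the other hand \<open>m\<close> is a Lie element, and the exterior algebra contains very few of those: for
  vectors \<open>[x, y] = 2 x \<and> y\<close>, and \<open>\<Lambda>\<^sup>2\<close> is central, so the Lie algebra generated by \<open>V\<close> in \<open>\<Lambda>(V)\<close> is
  \<open>V \<oplus> \<Lambda>\<^sup>2 V\<close>. Since \<open>\<pi> m\<close> has degree \<open>j \<ge> 3\<close>, it vanishes (\<open>abs_exterior_free_lie_part\<close>). So \<open>c w = 0\<close>. If
  \<open>c = 0\<close> then \<open>m = 0\<close>; if \<open>w = 0\<close> then \<open>m = F 0 = 0\<close>.

  Independence of words enters only through eigenvectors: a vector that lies in a span of eigenvectors
  and is itself an eigenvector needs only those of its own eigenvalue
  (\<open>eigenvector_in_span_eigenvectors\<close>). This gives both the weights above and the grading of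
  \<open>\<Lambda>(V)\<close>.

  Everything is done for a subspace \<open>U\<close> of the ambient space and those automorphisms of the latter that
  map \<open>U\<close> into itself. The whole space is the case of \<open>Hom_GL\<close>; a component \<open>\<eta>\<^sub>U\<close> of a natural
  transformation commutes with all these automorphisms, so it is covered as well.
\<close>

section \<open>Linear maps, spans and eigenvectors\<close>

lemma clinearI:
  assumes "\<And>x y. f (x + y) = f x + f y" "\<And>c x. f (c *\<^sub>C x) = c *\<^sub>C f x"
  shows "clinear f"
  unfolding Vector_Spaces.linear_iff by (intro conjI allI assms cvs.vector_space_axioms)

lemma clinear_add: "clinear f \<Longrightarrow> f (x + y) = f x + f y"
  and clinear_scaleC: "clinear f \<Longrightarrow> f (c *\<^sub>C x) = c *\<^sub>C f x"
  unfolding Vector_Spaces.linear_iff by blast+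

lemma clinear_zero: "clinear f \<Longrightarrow> f 0 = 0"
  using clinear_scaleC[of f 0 0] by simp

lemma clinear_diff: "clinear f \<Longrightarrow> f (x - y) = f x - f y"
  using clinear_add[of f "x - y" y] by simp

lemma clinear_maps_span:
  assumes f: "clinear f" and x: "x \<in> cvs.span S" and S: "\<And>s. s \<in> S \<Longrightarrow> f s \<in> cvs.span T"
  shows "f x \<in> cvs.span T"
  using x
  by (induction rule: cvs.span_induct_alt)
    (simp_all add: clinear_zero[OF f] clinear_add[OF f] clinear_scaleC[OF f] S
      cvs.span_zero cvs.span_add cvs.span_scale)

text \<open>
  The eigenvectors form a family, not a set, because the eigenvalue of a word is read off from the list
  of its letters, and different lists may have the same value in the algebra. The proof removes one
  index \<open>i\<close> of the wrong eigenvalue at a time: \<open>g - ev i\<close> annihilates \<open>e i\<close> and multiplies \<open>x\<close> by the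
  nonzero scalar \<open>\<mu> - ev i\<close>.
\<close>

lemma eigenvector_in_span_eigenvectors:
  fixes e :: "'i \<Rightarrow> 'a::complex_vector"
  assumes g: "clinear g" and e: "\<And>i. i \<in> I \<Longrightarrow> g (e i) = ev i *\<^sub>C e i"
    and x: "x \<in> cvs.span (e ` I)" and gx: "g x = \<mu> *\<^sub>C x"
  shows "x \<in> cvs.span (e ` {i \<in> I. ev i = \<mu>})"
proof -
  have fin: "x \<in> cvs.span (e ` {i \<in> J. ev i = \<mu>})"
    if "finite J" "J \<subseteq> I" "x \<in> cvs.span (e ` J)" "g x = \<mu> *\<^sub>C x" for J x
    using that
  proof (induction J arbitrary: x rule: finite_induct)
    case empty
    then show ?case by simp
  next
    case (insert i J)
    then have ei: "g (e i) = ev i *\<^sub>C e i" by (auto intro: e)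
    obtain k where y: "x - k *\<^sub>C e i \<in> cvs.span (e ` J)"
      using insert.prems(2) by (auto simp: cvs.span_breakdown_eq)
    define y where "y = x - k *\<^sub>C e i"
    have gy: "g y = \<mu> *\<^sub>C x - k *\<^sub>C ev i *\<^sub>C e i"
      by (simp add: y_def clinear_diff[OF g] clinear_scaleC[OF g] insert.prems ei)
    show ?case
    proof (cases "ev i = \<mu>")
      case True
      then have "g y = \<mu> *\<^sub>C y"
        by (simp add: gy, simp add: y_def cvs.scale_right_diff_distrib scaleC_scaleC mult.commute)
      then have "y \<in> cvs.span (e ` {i \<in> J. ev i = \<mu>})"
        using insert.IH y insert.prems by (simp add: y_def)
      then have "y \<in> cvs.span (e ` {i' \<in> insert i J. ev i' = \<mu>})"
        by (rule cvs.span_mono[THEN subsetD, rotated]) auto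
      moreover have "e i \<in> cvs.span (e ` {i' \<in> insert i J. ev i' = \<mu>})"
        using True by (intro cvs.span_base) auto
      ultimately have "y + k *\<^sub>C e i \<in> cvs.span (e ` {i' \<in> insert i J. ev i' = \<mu>})"
        by (intro cvs.span_add cvs.span_scale)
      then show ?thesis by (simp add: y_def)
    next
      case False
      have "g y \<in> cvs.span (e ` J)"
      proof (rule clinear_maps_span[OF g, of _ "e ` J"])
        show "y \<in> cvs.span (e ` J)" using y by (simp add: y_def)
        show "g s \<in> cvs.span (e ` J)" if "s \<in> e ` J" for s
          using that insert.prems(1) e cvs.span_scale[OF cvs.span_base[OF that]] by auto
      qed
      then have "g y - ev i *\<^sub>C y \<in> cvs.span (e ` J)"
        using y by (simp add: y_def cvs.span_diff cvs.span_scale)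
      also have "g y - ev i *\<^sub>C y = (\<mu> - ev i) *\<^sub>C x"
        by (simp add: gy, simp add: y_def cvs.scale_right_diff_distrib cvs.scale_left_diff_distrib
            scaleC_scaleC mult.commute)
      finally have "inverse (\<mu> - ev i) *\<^sub>C (\<mu> - ev i) *\<^sub>C x \<in> cvs.span (e ` J)"
        by (rule cvs.span_scale)
      then have "x \<in> cvs.span (e ` J)"
        using False by (simp add: scaleC_scaleC scaleC_one)
      then have "x \<in> cvs.span (e ` {i \<in> J. ev i = \<mu>})"
        using insert by simp
      then show ?thesis
        by (rule cvs.span_mono[THEN subsetD, rotated]) auto
    qed
  qed
  obtain T r where "finite T" "T \<subseteq> e ` I" "x = (\<Sum>a\<in>T. r a *\<^sub>C a)"
    using x unfolding cvs.span_explicit by blast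
  moreover from this(1,2) obtain J where "finite J" "J \<subseteq> I" "T = e ` J"
    using finite_subset_image by metis
  ultimately have "finite J" "J \<subseteq> I" "x \<in> cvs.span (e ` J)"
    by (auto intro!: cvs.span_sum cvs.span_scale intro: cvs.span_base)
  with fin gx have "x \<in> cvs.span (e ` {i \<in> J. ev i = \<mu>})" by blast
  with \<open>J \<subseteq> I\<close> show ?thesis
    by (rule_tac cvs.span_mono[THEN subsetD, rotated]) auto
qed

text \<open>The scalings below are by \<open>2\<close>, so that eigenvalues \<open>2 ^ n\<close> separate all degrees.\<close>

lemma power_two_eq_iff: "(2 :: complex) ^ m = 2 ^ n \<longleftrightarrow> m = n"
proof -
  have "(2 :: complex) ^ m = of_nat (2 ^ m)" "(2 :: complex) ^ n = of_nat (2 ^ n)" by simp_all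
  then show ?thesis by (simp only: of_nat_eq_iff) simp
qed

text \<open>
  Scalings of single basis vectors and permutations of the basis are the only group elements on which
  equivariance is tested; this monomial form covers both.
\<close>

lemma basis_automorphism:
  fixes B :: "'v::complex_vector set"
  assumes B: "cvs.independent B" "cvs.span B = UNIV" and \<sigma>: "bij_betw \<sigma> B B"
    and c: "\<And>b. b \<in> B \<Longrightarrow> c b \<noteq> 0"
  obtains g where "g \<in> GL" "\<And>b. b \<in> B \<Longrightarrow> g b = c b *\<^sub>C \<sigma> b"
proof -
  interpret P: vector_space_pair "scaleC :: _ \<Rightarrow> 'v \<Rightarrow> 'v" "scaleC :: _ \<Rightarrow> 'v \<Rightarrow> 'v"
    by unfold_locales
  define \<tau> where "\<tau> = inv_into B \<sigma>"
  have \<tau>: "\<tau> b \<in> B" "\<sigma> (\<tau> b) = b" "\<sigma> b \<in> B" "\<tau> (\<sigma> b) = b" if "b \<in> B" for b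
    using that \<sigma> unfolding \<tau>_def bij_betw_def
    by (auto simp: inv_into_into f_inv_into_f)
  obtain g where g: "clinear g" "\<And>b. b \<in> B \<Longrightarrow> g b = c b *\<^sub>C \<sigma> b"
    using P.linear_independent_extend[OF B(1), of "\<lambda>b. c b *\<^sub>C \<sigma> b"] by blast
  obtain h where h: "clinear h" "\<And>b. b \<in> B \<Longrightarrow> h b = inverse (c (\<tau> b)) *\<^sub>C \<tau> b"
    using P.linear_independent_extend[OF B(1), of "\<lambda>b. inverse (c (\<tau> b)) *\<^sub>C \<tau> b"] by blast
  have id: "clinear (\<lambda>x :: 'v. x)" by (rule clinearI) simp_all
  have "clinear (\<lambda>x. g (h x))" "clinear (\<lambda>x. h (g x))"
    by (auto intro!: clinearI simp: clinear_add[OF g(1)] clinear_scaleC[OF g(1)]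
        clinear_add[OF h(1)] clinear_scaleC[OF h(1)])
  then have "g (h x) = x" "h (g x) = x" for x
    by (intro P.linear_eq_on[OF _ id, of _ x B];
        simp add: B g(2) h(2) \<tau> clinear_scaleC[OF g(1)] clinear_scaleC[OF h(1)] c scaleC_scaleC scaleC_one)+
  then have "bij g" by (rule_tac o_bij[of h]) (simp_all add: fun_eq_iff)
  with g that show thesis by (auto simp: GL_def)
qed

section \<open>Words in a complex algebra\<close>

text \<open>
  The tensor and the exterior algebra share the facts about products of vectors, which are proved once
  for a linear map \<open>\<iota>\<close> from a vector space into an algebra.
\<close>

class complex_algebra = ring_1 + complex_vector +
  assumes scaleC_mult_left: "(c *\<^sub>C x) * y = c *\<^sub>C (x * y)"
    and scaleC_mult_right: "x * (c *\<^sub>C y) = c *\<^sub>C (x * y)"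

instance tensor :: (complex_vector) complex_algebra
  by standard (rule scaleC_tensor_mult_left scaleC_tensor_mult_right)+

instance exterior :: (complex_vector) complex_algebra
proof
  fix c and x y :: "'a exterior"
  show "(c *\<^sub>C x) * y = c *\<^sub>C (x * y)"
    by transfer (simp add: scaleC_tensor_mult_left ideal_generated.zero)
  show "x * (c *\<^sub>C y) = c *\<^sub>C (x * y)"
    by transfer (simp add: scaleC_tensor_mult_right ideal_generated.zero)
qed

lemma mult_in_span:
  fixes x y :: "'a::complex_algebra"
  assumes "x \<in> cvs.span X" "y \<in> cvs.span Y"
    and XY: "\<And>x y. x \<in> X \<Longrightarrow> y \<in> Y \<Longrightarrow> x * y \<in> cvs.span Z"
  shows "x * y \<in> cvs.span Z"
  using assms(1)
proof (induction rule: cvs.span_induct_alt)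
  case (step c x x')
  have "x * y \<in> cvs.span Z"
    using assms(2)
    by (induction rule: cvs.span_induct_alt)
      (simp_all add: distrib_left scaleC_mult_right cvs.span_zero cvs.span_add cvs.span_scale
        XY step.hyps)
  with step.IH show ?case
    by (simp add: distrib_right scaleC_mult_left cvs.span_add cvs.span_scale)
qed (simp add: cvs.span_zero)

lemma word_in_span_basis_words:
  fixes \<iota> :: "'v::complex_vector \<Rightarrow> 'a::complex_algebra"
  assumes \<iota>: "clinear \<iota>" and "set vs \<subseteq> cvs.span B"
  shows "prod_list (map \<iota> vs) \<in>
    cvs.span ((\<lambda>us. prod_list (map \<iota> us)) ` {us. length us = length vs \<and> set us \<subseteq> B})"
  using assms(2)
proof (induction vs)
  case (Cons v vs)
  have "\<iota> v \<in> cvs.span (\<iota> ` B)"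
    by (rule clinear_maps_span[OF \<iota>, of _ B]) (use Cons.prems in \<open>auto intro: cvs.span_base\<close>)
  then have "\<iota> v * prod_list (map \<iota> vs) \<in>
      cvs.span ((\<lambda>us. prod_list (map \<iota> us)) ` {us. length us = length (v # vs) \<and> set us \<subseteq> B})"
  proof (rule mult_in_span)
    show "prod_list (map \<iota> vs) \<in>
      cvs.span ((\<lambda>us. prod_list (map \<iota> us)) ` {us. length us = length vs \<and> set us \<subseteq> B})"
      using Cons by simp
    fix x y
    assume "x \<in> \<iota> ` B"
      and "y \<in> (\<lambda>us. prod_list (map \<iota> us)) ` {us. length us = length vs \<and> set us \<subseteq> B}"
    then obtain b us where "b \<in> B" "x = \<iota> b" "length us = length vs" "set us \<subseteq> B"
      "y = prod_list (map \<iota> us)" by blast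
    then show "x * y \<in>
      cvs.span ((\<lambda>us. prod_list (map \<iota> us)) ` {us. length us = length (v # vs) \<and> set us \<subseteq> B})"
      by (intro cvs.span_base image_eqI[of _ _ "b # us"]) auto
  qed
  then show ?case by simp
qed (auto intro!: cvs.span_base image_eqI[of _ _ "[]"])

lemma prod_list_scaleC:
  fixes \<iota> :: "'v \<Rightarrow> 'a::complex_algebra"
  shows "prod_list (map (\<lambda>v. c v *\<^sub>C \<iota> v) vs) = prod_list (map c vs) *\<^sub>C prod_list (map \<iota> vs)"
  by (induction vs)
    (simp_all add: scaleC_one scaleC_mult_left scaleC_mult_right scaleC_scaleC mult.commute)

lemma clinear_tensor_of: "clinear tensor_of"
  by (rule clinearI) (rule tensor_of_add tensor_of_scaleC)+

lemma clinear_abs_exterior: "clinear abs_exterior"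
  by (rule clinearI) (simp_all add: plus_exterior.abs_eq scaleC_exterior.abs_eq)

lemma exterior_of_eq: "exterior_of v = abs_exterior (tensor_of v)"
  by (simp add: exterior_of.abs_eq)

lemma clinear_exterior_of: "clinear exterior_of"
  by (rule clinearI)
    (simp_all add: exterior_of_eq tensor_of_add tensor_of_scaleC clinear_add[OF clinear_abs_exterior]
      clinear_scaleC[OF clinear_abs_exterior])

abbreviation tensor_word :: "'v::complex_vector list \<Rightarrow> 'v tensor"
  where "tensor_word vs \<equiv> prod_list (map tensor_of vs)"

abbreviation exterior_word :: "'v::complex_vector list \<Rightarrow> 'v exterior"
  where "exterior_word vs \<equiv> prod_list (map exterior_of vs)"

lemma abs_exterior_word: "abs_exterior (tensor_word vs) = exterior_word vs"
  by (induction vs)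
    (simp_all add: one_exterior.abs_eq[symmetric] times_exterior.abs_eq[symmetric] exterior_of_eq)

lemma clinear_tensor_map: "clinear f \<Longrightarrow> clinear (tensor_map f)"
  by (rule clinearI) (simp_all add: tensor_map_add tensor_map_scaleC)

lemma clinear_exterior_map: "clinear f \<Longrightarrow> clinear (exterior_map f)"
  by (rule clinearI) (simp_all add: exterior_map_add exterior_map_scaleC)

lemma tensor_map_word: "clinear f \<Longrightarrow> tensor_map f (tensor_word vs) = tensor_word (map f vs)"
  by (induction vs) (simp_all add: tensor_map_one tensor_map_mult tensor_map_of)

lemma exterior_map_word: "clinear f \<Longrightarrow> exterior_map f (exterior_word vs) = exterior_word (map f vs)"
  by (induction vs) (simp_all add: exterior_map_one exterior_map_mult exterior_map_of)

lemma tensor_word_scaled: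
  assumes "\<And>v. v \<in> set vs \<Longrightarrow> f v = c v *\<^sub>C v"
  shows "tensor_word (map f vs) = prod_list (map c vs) *\<^sub>C tensor_word vs"
proof -
  have "map tensor_of (map f vs) = map (\<lambda>v. c v *\<^sub>C tensor_of v) vs"
    using assms by (simp add: tensor_of_scaleC)
  then show ?thesis by (simp only: prod_list_scaleC)
qed

lemma exterior_word_scaled:
  assumes "\<And>v. v \<in> set vs \<Longrightarrow> f v = c v *\<^sub>C v"
  shows "exterior_word (map f vs) = prod_list (map c vs) *\<^sub>C exterior_word vs"
proof -
  have "map exterior_of (map f vs) = map (\<lambda>v. c v *\<^sub>C exterior_of v) vs"
    using assms by (simp add: clinear_scaleC[OF clinear_exterior_of])
  then show ?thesis by (simp only: prod_list_scaleC)
qed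

section \<open>The sign rule in the exterior algebra\<close>

lemma exterior_of_anticommute:
  "exterior_of u * exterior_of v = - (exterior_of v * exterior_of u)"
proof -
  have "0 = exterior_of (u + v) * exterior_of (u + v)" by (simp add: exterior_of_square)
  also have "\<dots> = exterior_of u * exterior_of v + exterior_of v * exterior_of u"
    by (simp add: clinear_add[OF clinear_exterior_of] distrib_left distrib_right exterior_of_square)
  finally show ?thesis by (simp add: eq_neg_iff_add_eq_0)
qed

text \<open>
  Moving the left \<open>x\<close> through the word changes at most the sign, and brings it next to the right \<open>x\<close>.
\<close>

lemma exterior_of_enclosing_word: "exterior_of x * (exterior_word us * exterior_of x) = 0"
proof (induction us)
  case (Cons u us)
  have "exterior_of x * (exterior_word (u # us) * exterior_of x) =
      exterior_of x * exterior_of u * (exterior_word us * exterior_of x)"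
    by (simp add: mult.assoc)
  also have "\<dots> = - (exterior_of u * (exterior_of x * (exterior_word us * exterior_of x)))"
    by (simp add: exterior_of_anticommute[of x u] mult.assoc)
  finally show ?case using Cons by simp
qed (simp add: exterior_of_square)

lemma exterior_word_repeated: "exterior_word (us @ x # ws @ x # zs) = 0"
proof -
  have "exterior_word (us @ x # ws @ x # zs) =
    exterior_word us * (exterior_of x * (exterior_word ws * exterior_of x)) * exterior_word zs"
    by (simp add: mult.assoc)
  then show ?thesis by (simp only: exterior_of_enclosing_word) simp
qed

text \<open>Polarisation: expand the word with \<open>x + y\<close> at both places.\<close>

lemma exterior_word_swap:
  "exterior_word (us @ x # ws @ y # zs) = - exterior_word (us @ y # ws @ x # zs)"
proof -
  have "0 = exterior_word (us @ (x + y) # ws @ (x + y) # zs)"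
    by (rule exterior_word_repeated[symmetric])
  also have "\<dots> = exterior_word (us @ x # ws @ x # zs) + exterior_word (us @ y # ws @ y # zs) +
      (exterior_word (us @ x # ws @ y # zs) + exterior_word (us @ y # ws @ x # zs))"
    by (simp add: clinear_add[OF clinear_exterior_of] distrib_left distrib_right mult.assoc)
  finally show ?thesis by (simp only: exterior_word_repeated) (simp add: eq_neg_iff_add_eq_0)
qed

lemma exterior_word_not_distinct: "\<not> distinct vs \<Longrightarrow> exterior_word vs = 0"
  using not_distinct_decomp[of vs] exterior_word_repeated by fastforce

lemma exterior_word_transpose:
  assumes vs: "distinct vs" and ab: "a \<in> set vs" "b \<in> set vs" "a \<noteq> b"
  shows "exterior_word (map (Transposition.transpose a b) vs) = - exterior_word vs"
proof -
  have *: "exterior_word (map (Transposition.transpose a b) vs) = - exterior_word vs"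
    if d: "vs = us @ a # ws @ b # zs" "distinct vs" for a b us ws zs
  proof -
    have "map (Transposition.transpose a b) xs = xs" if "a \<notin> set xs" "b \<notin> set xs" for xs
      using that by (induction xs) (auto simp: transpose_apply_other)
    then have "map (Transposition.transpose a b) vs = us @ b # ws @ a # zs"
      using d by auto
    then show ?thesis using d exterior_word_swap[of us b ws a zs] by simp
  qed
  obtain us r where "vs = us @ a # r" using ab split_list by metis
  moreover have "b \<in> set us \<or> b \<in> set r" using ab calculation by auto
  ultimately consider ws zs where "vs = us @ a # ws @ b # zs" | ws zs where "vs = ws @ b # zs @ a # r"
    using split_list[of b us] split_list[of b r] by auto
  then show ?thesis
    using *[OF _ vs] by cases (metis, metis transpose_commute)
qed

lemma exterior_word_permute:
  assumes vs: "distinct vs" and \<sigma>: "\<sigma> permutes set vs"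
  shows "exterior_word (map \<sigma> vs) = of_int (sign \<sigma>) *\<^sub>C exterior_word vs"
  using \<sigma> finite_set[of vs]
proof (induction rule: permutes_induct)
  case (swap a b p)
  then have "distinct (map p vs)" "set (map p vs) = set vs"
    using vs by (auto simp: distinct_map permutes_inj_on permutes_image)
  then have "exterior_word (map (Transposition.transpose a b) (map p vs)) = - exterior_word (map p vs)"
    using swap by (intro exterior_word_transpose) auto
  moreover have "permutation p" using swap permutation_permutes by blast
  ultimately show ?case
    using swap by (simp add: sign_compose permutation_swap_id sign_swap_id del: o_apply)
qed (simp add: scaleC_one)

section \<open>Lie elements in the exterior algebra\<close>

text \<open>
  The endomorphism induced by \<open>v \<mapsto> 2 v\<close> multiplies \<open>\<Lambda>\<^sup>n\<close> by \<open>2 ^ n\<close>, so distinct degrees are distinct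
  eigenspaces.
\<close>

lemma exterior_grading:
  fixes x :: "'v::complex_vector exterior"
  assumes "x \<in> exterior_power j UNIV" "x \<in> cvs.span (exterior_word ` {us. length us \<in> K})" "j \<notin> K"
  shows "x = 0"
proof -
  define d where "d = exterior_map (\<lambda>v :: 'v. 2 *\<^sub>C v)"
  have s: "clinear (\<lambda>v :: 'v. 2 *\<^sub>C v)"
    by (rule clinearI) (simp_all add: scaleC_add_right scaleC_scaleC mult.commute)
  have d: "clinear d" unfolding d_def by (rule clinear_exterior_map[OF s])
  have dw: "d (exterior_word us) = 2 ^ length us *\<^sub>C exterior_word us" for us
    unfolding d_def exterior_map_word[OF s]
    using exterior_word_scaled[of us _ "\<lambda>_. 2"] by (simp add: map_replicate_const)
  have "d x = 2 ^ j *\<^sub>C x"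
    using assms(1) unfolding exterior_power_def
    by (induction rule: cvs.span_induct_alt)
      (auto simp: clinear_zero[OF d] clinear_add[OF d] clinear_scaleC[OF d] dw scaleC_add_right
        scaleC_scaleC mult.commute)
  then have "x \<in> cvs.span (exterior_word ` {us \<in> {us. length us \<in> K}. (2 :: complex) ^ length us = 2 ^ j})"
    by (intro eigenvector_in_span_eigenvectors[OF d _ assms(2)]) (auto simp: dw)
  then have "x \<in> cvs.span (exterior_word ` {us. length us \<in> K \<and> length us = j})"
    by (simp add: power_two_eq_iff)
  also have "{us :: 'v list. length us \<in> K \<and> length us = j} = {}" using assms(3) by auto
  finally show ?thesis by simp
qed

text \<open>Passing two letters costs two signs.\<close>

lemma exterior_word2_central:
  assumes "length us = 2"
  shows "exterior_word us * exterior_of v = exterior_of v * exterior_word us"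
proof -
  obtain a b where us: "us = [a, b]" using assms by (auto simp: length_Suc_conv numeral_2_eq_2)
  have "exterior_word us * exterior_of v = exterior_of a * (exterior_of b * exterior_of v)"
    by (simp add: us mult.assoc)
  also have "\<dots> = - ((exterior_of a * exterior_of v) * exterior_of b)"
    by (simp add: exterior_of_anticommute[of b v] mult.assoc)
  also have "\<dots> = exterior_of v * exterior_word us"
    by (simp add: exterior_of_anticommute[of a v] us mult.assoc)
  finally show ?thesis .
qed

lemma exterior_word2_commutes:
  assumes "length us = 2"
  shows "exterior_word us * exterior_word vs = exterior_word vs * exterior_word us"
proof (induction vs)
  case (Cons v vs)
  have "exterior_word us * exterior_word (v # vs) =
      (exterior_word us * exterior_of v) * exterior_word vs"
    by (simp add: mult.assoc)
  also have "\<dots> = exterior_of v * (exterior_word us * exterior_word vs)"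
    by (simp only: exterior_word2_central[OF assms] mult.assoc)
  finally show ?case by (simp add: Cons mult.assoc)
qed simp

abbreviation low_words :: "'v::complex_vector exterior set"
  where "low_words \<equiv> exterior_word ` {us. length us \<in> {1, 2}}"

lemma commutator_low_words:
  assumes "x \<in> low_words" "y \<in> low_words"
  shows "x * y - y * x \<in> cvs.span low_words"
proof -
  obtain us vs where us: "x = exterior_word us" "length us \<in> {1, 2}"
    and vs: "y = exterior_word vs" "length vs \<in> {1, 2}"
    using assms by blast
  show ?thesis
  proof (cases "length us = 2 \<or> length vs = 2")
    case True
    then have "x * y = y * x" using exterior_word2_commutes us vs by metis
    then show ?thesis by (simp add: cvs.span_zero)
  next
    case False
    then obtain u v where "us = [u]" "vs = [v]"
      using us vs by (auto simp: length_Suc_conv)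
    then have "x * y - y * x = exterior_word [u, v] + exterior_word [u, v]"
      using us vs by (simp add: exterior_of_anticommute[of v u])
    moreover have "exterior_word [u, v] \<in> low_words" by (rule imageI) simp
    ultimately show ?thesis by (metis cvs.span_add cvs.span_base)
  qed
qed

lemma commutator_in_span:
  fixes x y :: "'a::complex_algebra"
  assumes "x \<in> cvs.span X" "y \<in> cvs.span Y"
    and XY: "\<And>x y. x \<in> X \<Longrightarrow> y \<in> Y \<Longrightarrow> x * y - y * x \<in> cvs.span Z"
  shows "x * y - y * x \<in> cvs.span Z"
proof -
  have l: "clinear (\<lambda>x. x * y - y * x)" "clinear (\<lambda>y. x * y - y * x)" for x y :: 'a
    by (auto intro!: clinearI simp: scaleC_mult_left scaleC_mult_right algebra_simps
        cvs.scale_right_diff_distrib)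
  show ?thesis
    by (rule clinear_maps_span[OF l(1) assms(1)], rule clinear_maps_span[OF l(2) assms(2)], rule XY)
qed

text \<open>
  By the preceding lemmas \<open>V + \<Lambda>\<^sup>2 V\<close> is closed under commutators, so it contains the image of the Lie
  algebra generated by \<open>V\<close>.
\<close>

lemma abs_exterior_free_lie:
  "x \<in> free_lie UNIV \<Longrightarrow> abs_exterior x \<in> cvs.span low_words"
proof (induction rule: free_lie.induct)
  case (gen v)
  have "abs_exterior (tensor_of v) = exterior_word [v]" by (simp add: exterior_of_eq)
  moreover have "exterior_word [v] \<in> low_words" by (rule imageI) simp
  ultimately show ?case by (metis cvs.span_base)
next
  case (bracket x y)
  have "abs_exterior (x * y - y * x) =
      abs_exterior x * abs_exterior y - abs_exterior y * abs_exterior x"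
    by (simp add: times_exterior.abs_eq minus_exterior.abs_eq)
  then show ?case
    by (simp only: commutator_in_span[OF bracket.IH commutator_low_words])
qed (simp_all add: clinear_zero[OF clinear_abs_exterior] clinear_add[OF clinear_abs_exterior]
    clinear_scaleC[OF clinear_abs_exterior] cvs.span_zero cvs.span_add cvs.span_scale)

lemma tensor_power_mono: "U \<subseteq> W \<Longrightarrow> tensor_power j U \<subseteq> tensor_power j W"
  unfolding tensor_power_def by (rule cvs.span_mono) blast

lemma abs_exterior_tensor_power:
  "x \<in> tensor_power j U \<Longrightarrow> abs_exterior x \<in> exterior_power j U"
  unfolding tensor_power_def exterior_power_def
  by (erule clinear_maps_span[OF clinear_abs_exterior])
    (auto simp: abs_exterior_word intro!: cvs.span_base)

lemma free_lie_mono: "U \<subseteq> W \<Longrightarrow> free_lie U \<subseteq> free_lie W"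
proof
  fix x assume "x \<in> free_lie U" "U \<subseteq> W"
  then show "x \<in> free_lie W" by (induction rule: free_lie.induct) (auto intro: free_lie.intros)
qed

lemma abs_exterior_free_lie_part:
  assumes "j \<ge> 3" "x \<in> free_lie_part j U"
  shows "abs_exterior x = 0"
proof (rule exterior_grading)
  have "x \<in> free_lie UNIV" "x \<in> tensor_power j UNIV"
    using assms(2) free_lie_mono[of U UNIV] tensor_power_mono[of U UNIV]
    by (auto simp: free_lie_part_def)
  then show "abs_exterior x \<in> cvs.span low_words" "abs_exterior x \<in> exterior_power j UNIV"
    using abs_exterior_free_lie abs_exterior_tensor_power by blast+
qed (use assms in auto)

section \<open>Equivariant maps\<close>

lemma permutation_word:
  assumes vs: "distinct vs" and us: "distinct us" "set us = set vs"
  obtains \<tau> where "\<tau> permutes set vs" "us = map \<tau> vs"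
proof -
  have len: "length us = length vs" using assms by (metis distinct_card)
  define n where "n = length vs"
  define i where "i = inv_into {..<n} ((!) vs)"
  define \<tau> where "\<tau> v = (if v \<in> set vs then us ! i v else v)" for v
  have bv: "bij_betw ((!) vs) {..<n} (set vs)" and bu: "bij_betw ((!) us) {..<n} (set vs)"
    using assms len by (auto simp: n_def intro: bij_betw_nth)
  have "bij_betw (\<lambda>v. us ! i v) (set vs) (set vs)"
    using bij_betw_trans[OF bij_betw_inv_into[OF bv] bu] by (simp add: i_def o_def)
  then have "bij_betw \<tau> (set vs) (set vs)"
    by (rule bij_betw_cong[THEN iffD1, rotated]) (simp add: \<tau>_def)
  then have "\<tau> permutes set vs" by (rule bij_imp_permutes) (simp add: \<tau>_def)
  moreover have "us = map \<tau> vs"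
  proof (rule nth_equalityI)
    fix k assume "k < length us"
    then have "k < n" by (simp add: len n_def)
    then have "i (vs ! k) = k"
      unfolding i_def using bij_betw_inv_into_left[OF bv] by simp
    then show "us ! k = map \<tau> vs ! k" using \<open>k < n\<close> by (simp add: \<tau>_def n_def)
  qed (simp add: len)
  ultimately show thesis by (rule that)
qed

lemma sign_sum_permuted:
  fixes f :: "('v \<Rightarrow> 'v) \<Rightarrow> 'a::complex_vector"
  assumes S: "finite S" and \<tau>: "\<tau> permutes S"
  shows "(\<Sum>\<sigma> | \<sigma> permutes S. of_int (sign \<sigma>) *\<^sub>C f (\<sigma> \<circ> \<tau>)) =
    of_int (sign \<tau>) *\<^sub>C (\<Sum>\<sigma> | \<sigma> permutes S. of_int (sign \<sigma>) *\<^sub>C f \<sigma>)"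
proof -
  have perm: "permutation \<sigma>" if "\<sigma> permutes S" for \<sigma>
    using that S permutation_permutes by blast
  have "(\<Sum>\<sigma> | \<sigma> permutes S. of_int (sign \<sigma>) *\<^sub>C f (\<sigma> \<circ> \<tau>)) =
      (\<Sum>\<sigma> | \<sigma> permutes S. of_int (sign \<tau>) *\<^sub>C of_int (sign \<sigma>) *\<^sub>C f \<sigma>)"
  proof (rule sum.reindex_bij_witness[where i = "\<lambda>\<sigma>. \<sigma> \<circ> inv \<tau>" and j = "\<lambda>\<sigma>. \<sigma> \<circ> \<tau>"])
    fix \<sigma> assume "\<sigma> \<in> {\<sigma>. \<sigma> permutes S}"
    then have \<sigma>: "\<sigma> permutes S" by simp
    have "sign \<tau> * sign (\<sigma> \<circ> \<tau>) = sign \<sigma>"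
      using sign_compose[OF perm[OF \<sigma>] perm[OF \<tau>]] by (simp add: mult.left_commute)
    then show "of_int (sign \<tau>) *\<^sub>C of_int (sign (\<sigma> \<circ> \<tau>)) *\<^sub>C f (\<sigma> \<circ> \<tau>) =
        of_int (sign \<sigma>) *\<^sub>C f (\<sigma> \<circ> \<tau>)"
      by (simp add: scaleC_scaleC flip: of_int_mult)
  qed (use \<tau> in \<open>auto simp: comp_assoc permutes_inv_o permutes_compose permutes_inv\<close>)
  then show ?thesis by (simp add: cvs.scale_sum_right)
qed

text \<open>
  Antisymmetrisation sends the word rearranged by \<open>\<tau>\<close> to \<open>sign \<tau>\<close> times the antisymmetrised word \<open>vs\<close>,
  and the projection to the exterior algebra sends it to \<open>sign \<tau>\<close> times the exterior word. Both are
  linear, so the same scalar \<open>c\<close> works for every combination of rearrangements. On an alternating \<open>m\<close>,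
  antisymmetrisation is multiplication by the number of permutations.
\<close>

lemma alternating_combination_of_permuted_words:
  fixes m :: "'v::complex_vector tensor"
  assumes vs: "distinct vs"
    and m: "m \<in> cvs.span (tensor_word ` {us. distinct us \<and> set us = set vs})"
    and g: "\<And>\<sigma>. \<sigma> permutes set vs \<Longrightarrow> clinear (g \<sigma>)"
      "\<And>\<sigma> v. \<sigma> permutes set vs \<Longrightarrow> v \<in> set vs \<Longrightarrow> g \<sigma> v = \<sigma> v"
    and alt: "\<And>\<sigma>. \<sigma> permutes set vs \<Longrightarrow> tensor_map (g \<sigma>) m = of_int (sign \<sigma>) *\<^sub>C m"
  obtains c where "fact (length vs) *\<^sub>C m =
      c *\<^sub>C (\<Sum>\<sigma> | \<sigma> permutes set vs. of_int (sign \<sigma>) *\<^sub>C tensor_word (map \<sigma> vs))"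
    "abs_exterior m = c *\<^sub>C exterior_word vs"
proof -
  define a where "a = (\<Sum>\<sigma> | \<sigma> permutes set vs. of_int (sign \<sigma>) *\<^sub>C tensor_word (map \<sigma> vs))"
  define A where "A x = (\<Sum>\<sigma> | \<sigma> permutes set vs. of_int (sign \<sigma>) *\<^sub>C tensor_map (g \<sigma>) x)" for x
  have A: "clinear A"
    unfolding A_def
    by (rule clinearI)
      (simp_all add: tensor_map_add tensor_map_scaleC g scaleC_add_right sum.distrib
        cvs.scale_sum_right scaleC_scaleC mult.commute)
  have "\<exists>c. A m = c *\<^sub>C a \<and> abs_exterior m = c *\<^sub>C exterior_word vs"
    using m
  proof (induction rule: cvs.span_induct_alt)
    case base
    show ?case
      by (rule exI[of _ 0]) (simp add: clinear_zero[OF A] clinear_zero[OF clinear_abs_exterior])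
  next
    case (step k x y)
    from step.hyps obtain us where us: "x = tensor_word us" "distinct us" "set us = set vs" by blast
    then obtain \<tau> where \<tau>: "\<tau> permutes set vs" "us = map \<tau> vs" by (metis permutation_word[OF vs])
    have "tensor_map (g \<sigma>) x = tensor_word (map (\<sigma> \<circ> \<tau>) vs)" if "\<sigma> permutes set vs" for \<sigma>
    proof -
      have "map (g \<sigma>) us = map (\<sigma> \<circ> \<tau>) vs"
        using that us(3) \<tau> by (auto simp: g permutes_in_image)
      then show ?thesis using that by (simp only: us tensor_map_word g)
    qed
    then have "A x = of_int (sign \<tau>) *\<^sub>C a"
      unfolding A_def a_def using sign_sum_permuted[OF finite_set \<tau>(1), of "\<lambda>\<sigma>. tensor_word (map \<sigma> vs)"]
      by simp
    moreover have "abs_exterior x = of_int (sign \<tau>) *\<^sub>C exterior_word vs"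
      by (simp only: us abs_exterior_word \<tau>(2) exterior_word_permute[OF vs \<tau>(1)])
    moreover obtain d where "A y = d *\<^sub>C a" "abs_exterior y = d *\<^sub>C exterior_word vs"
      using step.IH by blast
    ultimately have "A (k *\<^sub>C x + y) = (k * of_int (sign \<tau>) + d) *\<^sub>C a"
      "abs_exterior (k *\<^sub>C x + y) = (k * of_int (sign \<tau>) + d) *\<^sub>C exterior_word vs"
      by (simp_all only: clinear_add[OF A] clinear_scaleC[OF A] clinear_add[OF clinear_abs_exterior]
          clinear_scaleC[OF clinear_abs_exterior] scaleC_add_left scaleC_scaleC)
    then show ?case by blast
  qed
  moreover have "A m = fact (length vs) *\<^sub>C m"
  proof -
    have "A m = (\<Sum>\<sigma> | \<sigma> permutes set vs. m)"
      unfolding A_def by (rule sum.cong) (simp_all add: alt scaleC_scaleC scaleC_one flip: of_int_mult)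
    also have "\<dots> = of_nat (card {\<sigma>. \<sigma> permutes set vs}) *\<^sub>C m"
      by (simp only: cvs.sum_constant_scale)
    also have "card {\<sigma>. \<sigma> permutes set vs} = fact (length vs)"
      by (rule card_permutations) (simp_all add: distinct_card[OF vs])
    finally show ?thesis by simp
  qed
  ultimately obtain c where "fact (length vs) *\<^sub>C m = c *\<^sub>C a" "abs_exterior m = c *\<^sub>C exterior_word vs"
    by auto
  then show thesis unfolding a_def by (rule that)
qed

lemma prod_list_indicator:
  "prod_list (map (\<lambda>b. if b = v then c else 1) us) = (c :: 'a::comm_monoid_mult) ^ count_list us v"
  by (induction us) auto

lemma count_list_distinct: "distinct vs \<Longrightarrow> v \<in> set vs \<Longrightarrow> count_list vs v = 1"
  by (induction vs) (auto simp: count_list_0_iff)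

text \<open>
  Doubling one basis vector \<open>v\<close> makes every word in basis vectors an eigenvector of eigenvalue
  \<open>2 ^ n\<close>, with \<open>n\<close> the number of occurrences of \<open>v\<close>. Treating the members of \<open>A\<close> one after
  another filters out all words in which some member does not occur exactly once.
\<close>

lemma tensor_weight_space:
  fixes m :: "'v::complex_vector tensor"
  assumes B: "cvs.independent B" "cvs.span B = UNIV" and A: "finite A" "A \<subseteq> B"
    and m: "m \<in> tensor_power j UNIV"
    and weight: "\<And>g v. v \<in> A \<Longrightarrow> g \<in> GL \<Longrightarrow>
      (\<And>b. b \<in> B \<Longrightarrow> g b = (if b = v then 2 else 1) *\<^sub>C b) \<Longrightarrow> tensor_map g m = 2 *\<^sub>C m"
  shows "m \<in> cvs.span (tensor_word ` {us. length us = j \<and> set us \<subseteq> B \<and> (\<forall>v\<in>A. count_list us v = 1)})"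
  using A weight
proof (induction A rule: finite_induct)
  case empty
  have "tensor_power j (UNIV :: 'v set) \<subseteq> cvs.span (tensor_word ` {us. length us = j \<and> set us \<subseteq> B})"
    unfolding tensor_power_def
  proof (rule cvs.span_minimal)
    show "{tensor_word vs |vs :: 'v list. length vs = j \<and> set vs \<subseteq> UNIV}
      \<subseteq> cvs.span (tensor_word ` {us. length us = j \<and> set us \<subseteq> B})"
      using word_in_span_basis_words[OF clinear_tensor_of, of _ B] B by auto
  qed simp
  then show ?case using m by auto
next
  case (insert v A)
  let ?I = "{us. length us = j \<and> set us \<subseteq> B \<and> (\<forall>v\<in>A. count_list us v = 1)}"
  have IH: "m \<in> cvs.span (tensor_word ` ?I)"
    by (rule insert.IH) (use insert.prems in \<open>auto\<close>)
  obtain g where g: "g \<in> GL" "\<And>b. b \<in> B \<Longrightarrow> g b = (if b = v then 2 else 1) *\<^sub>C b"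
    by (rule basis_automorphism[OF B bij_betw_id, of "\<lambda>b. if b = v then 2 else 1"])
      (simp_all split: if_splits)
  then have lin: "clinear g" by (simp add: GL_def)
  have "tensor_map g (tensor_word us) = 2 ^ count_list us v *\<^sub>C tensor_word us" if "us \<in> ?I" for us
    using that tensor_word_scaled[of us g "\<lambda>b. if b = v then 2 else 1"] g(2)
    by (auto simp: tensor_map_word[OF lin] prod_list_indicator subset_eq)
  moreover have "tensor_map g m = 2 *\<^sub>C m" using insert.prems(2) g by blast
  ultimately have "m \<in> cvs.span (tensor_word ` {us \<in> ?I. (2 :: complex) ^ count_list us v = 2})"
    by (intro eigenvector_in_span_eigenvectors[OF clinear_tensor_map[OF lin] _ IH])
  moreover have "(2 :: complex) ^ n = 2 \<longleftrightarrow> n = 1" for n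
    using power_two_eq_iff[of n 1] by simp
  ultimately show ?case
    by (rule_tac cvs.span_mono[THEN subsetD, rotated]) auto
qed

text \<open>
  The hypothesis on \<open>B\<close> says that \<open>g\<close> induces the identity modulo \<open>U\<close>. Both kinds of automorphisms used
  below move only basis vectors that lie in \<open>U\<close>, so they qualify.
\<close>

lemma clinear_preserves_superspace:
  assumes g: "clinear g" and B: "cvs.span B = UNIV"
    and diff: "\<And>b. b \<in> B \<Longrightarrow> g b - b \<in> U" and U: "cvs.subspace U"
  shows "g ` U \<subseteq> U"
proof -
  have "clinear (\<lambda>x. g x - x)"
    by (rule clinearI)
      (simp_all add: clinear_add[OF g] clinear_scaleC[OF g] cvs.scale_right_diff_distrib)
  then have "g x - x \<in> cvs.span U" for x
    by (rule clinear_maps_span[of _ x B]) (auto simp: B diff intro: cvs.span_base)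
  then have "g x - x \<in> U" for x
    using U by (simp add: cvs.span_eq_iff[THEN iffD2])
  then have "g x \<in> U" if "x \<in> U" for x
    using cvs.subspace_add[OF U, of "g x - x" x] that by simp
  then show ?thesis by blast
qed

lemma exterior_power_word: "length vs = j \<Longrightarrow> set vs \<subseteq> U \<Longrightarrow> exterior_word vs \<in> exterior_power j U"
  unfolding exterior_power_def by (intro cvs.span_base) blast

lemma equivariant_map_kills_basis_word:
  fixes F :: "'v::complex_vector exterior \<Rightarrow> 'v tensor"
  assumes j: "j \<ge> 3" and U: "cvs.subspace U"
    and F: "linear_between (exterior_power j U) (free_lie_part j U) F"
    and equiv: "\<And>g x. g \<in> GL \<Longrightarrow> g ` U \<subseteq> U \<Longrightarrow> x \<in> exterior_power j U \<Longrightarrow>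
      F (exterior_map g x) = tensor_map g (F x)"
    and B: "cvs.independent B" "cvs.span B = UNIV"
    and vs: "distinct vs" "set vs \<subseteq> B" "set vs \<subseteq> U" "length vs = j"
  shows "F (exterior_word vs) = 0"
proof -
  define w m where "w = exterior_word vs" and "m = F w"
  have w: "w \<in> exterior_power j U" unfolding w_def using vs by (intro exterior_power_word)
  then have Lie: "m \<in> free_lie_part j U" and F_scale: "F (c *\<^sub>C w) = c *\<^sub>C m" for c
    using F by (auto simp: m_def linear_between_def)
  then have "m \<in> tensor_power j UNIV"
    using tensor_power_mono[of U UNIV] by (auto simp: free_lie_part_def)
  moreover have "tensor_map g m = 2 *\<^sub>C m"
    if g: "g \<in> GL" "v \<in> set vs"
      "\<And>b. b \<in> B \<Longrightarrow> g b = (if b = v then 2 else 1) *\<^sub>C b" for g v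
  proof -
    have lin: "clinear g" using g(1) by (simp add: GL_def)
    have "g b - b \<in> U" if "b \<in> B" for b
    proof (cases "b = v")
      case True
      then have "g b - b = v" using g(3)[OF that] scaleC_add_left[of 1 1 v] by (simp add: scaleC_one)
      then show ?thesis using g(2) vs by auto
    qed (use g(3)[OF that] cvs.subspace_0[OF U] in \<open>simp add: scaleC_one\<close>)
    then have "g ` U \<subseteq> U" by (rule clinear_preserves_superspace[OF lin B(2) _ U])
    then have "tensor_map g m = F (exterior_map g w)" using equiv g w by (simp add: m_def)
    also have "exterior_map g w = 2 *\<^sub>C w"
    proof -
      have "count_list vs v = 1" using count_list_distinct[OF vs(1)] g(2) by simp
      moreover have "exterior_word (map g vs) =
          prod_list (map (\<lambda>b. if b = v then 2 else 1) vs) *\<^sub>C exterior_word vs"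
        using g(3) vs by (intro exterior_word_scaled) auto
      ultimately show ?thesis
        unfolding w_def by (simp only: exterior_map_word[OF lin] prod_list_indicator power_one_right)
    qed
    finally show ?thesis by (simp only: F_scale)
  qed
  \<comment> \<open>Hence \<open>m\<close> has weight one in every \<open>v\<^sub>i\<close>; a word of length \<open>j\<close> with this property has no room for
      further letters.\<close>
  ultimately have "m \<in> cvs.span (tensor_word `
      {us. length us = j \<and> set us \<subseteq> B \<and> (\<forall>v\<in>set vs. count_list us v = 1)})"
    using vs by (intro tensor_weight_space[OF B]) auto
  moreover have "distinct us \<and> set us = set vs"
    if "length us = j" "\<forall>v\<in>set vs. count_list us v = 1" for us
  proof -
    have "set vs \<subseteq> set us" using that(2) by (metis count_notin subsetI zero_neq_one)
    moreover have "card (set us) \<le> card (set vs)"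
      using card_length[of us] that vs by (simp add: distinct_card)
    ultimately have "set us = set vs" by (metis List.finite_set card_seteq)
    then show ?thesis using that vs by (metis card_distinct distinct_card)
  qed
  ultimately have m: "m \<in> cvs.span (tensor_word ` {us. distinct us \<and> set us = set vs})"
    by (rule_tac cvs.span_mono[THEN subsetD, rotated]) auto

  \<comment> \<open>Permutations of the \<open>v\<^sub>i\<close> act on \<open>w\<close>, and so on \<open>m\<close>, by the sign.\<close>
  have "\<exists>g. g \<in> GL \<and> (\<forall>b\<in>B. g b = \<sigma> b)" if "\<sigma> permutes set vs" for \<sigma>
  proof -
    have "\<sigma> permutes B" using that vs(2) by (rule permutes_subset)
    then obtain g where "g \<in> GL" "\<And>b. b \<in> B \<Longrightarrow> g b = 1 *\<^sub>C \<sigma> b"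
      by (rule basis_automorphism[OF B permutes_imp_bij, of \<sigma> "\<lambda>_. 1"]) simp_all
    then show ?thesis by (auto simp: scaleC_one)
  qed
  then obtain g where "\<forall>\<sigma>. \<sigma> permutes set vs \<longrightarrow> g \<sigma> \<in> GL \<and> (\<forall>b\<in>B. g \<sigma> b = \<sigma> b)"
    by metis
  then have g: "g \<sigma> \<in> GL" "\<And>b. b \<in> B \<Longrightarrow> g \<sigma> b = \<sigma> b" if "\<sigma> permutes set vs" for \<sigma>
    using that by blast+
  then have lin: "clinear (g \<sigma>)" if "\<sigma> permutes set vs" for \<sigma>
    using that by (simp add: GL_def)
  have alt: "tensor_map (g \<sigma>) m = of_int (sign \<sigma>) *\<^sub>C m" if \<sigma>: "\<sigma> permutes set vs" for \<sigma>
  proof -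
    have "g \<sigma> b - b \<in> U" if "b \<in> B" for b
    proof (cases "b \<in> set vs")
      case True
      then have "\<sigma> b \<in> U" "b \<in> U" using permutes_in_image[OF \<sigma>] vs by auto
      then show ?thesis using U that by (simp add: g(2)[OF \<sigma>] cvs.subspace_diff)
    qed (use permutes_not_in[OF \<sigma>] cvs.subspace_0[OF U] that in \<open>simp add: g(2)[OF \<sigma>]\<close>)
    then have "g \<sigma> ` U \<subseteq> U" by (rule clinear_preserves_superspace[OF lin[OF \<sigma>] B(2) _ U])
    then have "tensor_map (g \<sigma>) m = F (exterior_map (g \<sigma>) w)"
      using equiv g(1)[OF \<sigma>] w by (simp add: m_def)
    also have "exterior_map (g \<sigma>) w = exterior_word (map (g \<sigma>) vs)"
      unfolding w_def by (rule exterior_map_word[OF lin[OF \<sigma>]])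
    also have "map (g \<sigma>) vs = map \<sigma> vs" using vs g(2)[OF \<sigma>] by auto
    also have "exterior_word \<dots> = of_int (sign \<sigma>) *\<^sub>C w"
      unfolding w_def by (rule exterior_word_permute[OF vs(1) \<sigma>])
    finally show ?thesis by (simp only: F_scale)
  qed
  obtain c where c: "fact (length vs) *\<^sub>C m =
      c *\<^sub>C (\<Sum>\<sigma> | \<sigma> permutes set vs. of_int (sign \<sigma>) *\<^sub>C tensor_word (map \<sigma> vs))"
    "abs_exterior m = c *\<^sub>C w"
    using alternating_combination_of_permuted_words[OF vs(1) m lin g(2) alt] vs(2)
    unfolding w_def by blast
  have "c *\<^sub>C w = 0" using abs_exterior_free_lie_part[OF j Lie] c(2) by simp
  then consider "c = 0" | "w = 0" by auto
  then have "m = 0"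
  proof cases
    case 1
    then have "fact (length vs) *\<^sub>C m = 0" using c(1) by simp
    then show ?thesis by simp
  next
    case 2
    then show ?thesis using F_scale[of 0] by (simp add: m_def)
  qed
  then show ?thesis by (simp add: m_def w_def)
qed

text \<open>
  The exterior power of \<open>U\<close> is spanned by words in a basis of \<open>U\<close>, which is enlarged to a basis of the
  ambient space so that automorphisms can be prescribed. Words with a repeated letter are zero.
\<close>

lemma equivariant_map_exterior_free_lie_zero:
  fixes F :: "'v::complex_vector exterior \<Rightarrow> 'v tensor"
  assumes j: "j \<ge> 3" and U: "cvs.subspace U"
    and F: "linear_between (exterior_power j U) (free_lie_part j U) F"
    and equiv: "\<And>g x. g \<in> GL \<Longrightarrow> g ` U \<subseteq> U \<Longrightarrow> x \<in> exterior_power j U \<Longrightarrow>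
      F (exterior_map g x) = tensor_map g (F x)"
    and x: "x \<in> exterior_power j U"
  shows "F x = 0"
proof -
  obtain C where C: "C \<subseteq> U" "cvs.independent C" "U \<subseteq> cvs.span C"
    using cvs.maximal_independent_subset by metis
  obtain B where B: "C \<subseteq> B" "cvs.independent B" "cvs.span B = UNIV"
    using cvs.extend_basis_superset[OF C(2)] cvs.independent_extend_basis[OF C(2)]
      cvs.span_extend_basis[OF C(2)] by blast
  let ?W = "exterior_word ` {us. length us = j \<and> set us \<subseteq> C}"
  have words: "F w = 0" "w \<in> exterior_power j U" if "w \<in> ?W" for w
  proof -
    obtain us where us: "w = exterior_word us" "length us = j" "set us \<subseteq> C"
      using \<open>w \<in> ?W\<close> by blast
    show w: "w \<in> exterior_power j U" using us C(1) by (auto intro: exterior_power_word)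
    show "F w = 0"
    proof (cases "distinct us")
      case True
      then show ?thesis
        unfolding us(1) using us B C(1)
        by (intro equivariant_map_kills_basis_word[OF j U F equiv B(2,3)]) auto
    next
      case False
      then have "w = 0 *\<^sub>C w" using us exterior_word_not_distinct by simp
      then show ?thesis using F w by (metis linear_between_def cvs.scale_zero_left)
    qed
  qed
  have "x \<in> cvs.span ?W"
    using x unfolding exterior_power_def
  proof (rule subsetD[OF cvs.span_minimal, rotated 2])
    show "{exterior_word vs |vs. length vs = j \<and> set vs \<subseteq> U} \<subseteq> cvs.span ?W"
      using word_in_span_basis_words[OF clinear_exterior_of, of _ C] C(3) by auto
  qed simp
  then have "x \<in> exterior_power j U \<and> F x = 0"
  proof (induction rule: cvs.span_induct_alt)
    case base
    have "0 \<in> exterior_power j U" by (simp add: exterior_power_def cvs.span_zero)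
    moreover from this have "F (0 *\<^sub>C 0) = 0 *\<^sub>C F 0" using F unfolding linear_between_def by blast
    ultimately show ?case by simp
  next
    case (step k w y)
    have "k *\<^sub>C w \<in> exterior_power j U"
      using words(2)[OF step.hyps] by (simp add: exterior_power_def cvs.span_scale)
    moreover have "F (k *\<^sub>C w) = 0"
      using F words[OF step.hyps] unfolding linear_between_def by simp
    ultimately show ?case
      using step.IH F unfolding linear_between_def
      by (auto simp: exterior_power_def cvs.span_add)
  qed
  then show ?thesis by blast
qed

theorem proposition8p5:
  fixes j :: nat
  assumes "j \<ge> 3" and "dim_ge j (UNIV :: 'v::complex_vector set)"
  shows "(Hom_GL j :: ('v exterior \<Rightarrow> 'v tensor) set) = {\<lambda>_. 0} \<and>
    \<not> (\<exists>\<eta> :: 'u::complex_vector set \<Rightarrow> 'u exterior \<Rightarrow> 'u tensor.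
        natural_transformation j \<eta> \<and> nonzero_transformation j \<eta>)"
proof
  have "F x = 0" if F: "F \<in> Hom_GL j" for F :: "'v exterior \<Rightarrow> 'v tensor" and x
  proof (cases "x \<in> exterior_power j UNIV")
    case True
    show ?thesis
      by (rule equivariant_map_exterior_free_lie_zero[OF assms(1) cvs.subspace_UNIV _ _ True])
        (use F in \<open>auto simp: Hom_GL_def\<close>)
  qed (use F in \<open>simp add: Hom_GL_def\<close>)
  moreover have "(\<lambda>_. 0) \<in> (Hom_GL j :: ('v exterior \<Rightarrow> 'v tensor) set)"
    by (auto simp: Hom_GL_def linear_between_def free_lie_part_def tensor_power_def free_lie.zero
        cvs.span_zero GL_def clinear_zero clinear_tensor_map)
  ultimately show "(Hom_GL j :: ('v exterior \<Rightarrow> 'v tensor) set) = {\<lambda>_. 0}" by blast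
next
  have "\<eta> U x = 0" if nat: "natural_transformation j \<eta>" and U: "U \<in> stable_spaces j"
    and x: "x \<in> exterior_power j U"
    for \<eta> :: "'u set \<Rightarrow> 'u exterior \<Rightarrow> 'u tensor" and U x
  proof (rule equivariant_map_exterior_free_lie_zero[OF assms(1) _ _ _ x])
    show "cvs.subspace U" using U by (simp add: stable_spaces_def)
    show "linear_between (exterior_power j U) (free_lie_part j U) (\<eta> U)"
      using nat U by (simp add: natural_transformation_def)
    show "\<eta> U (exterior_map g y) = tensor_map g (\<eta> U y)"
      if "g \<in> GL" "g ` U \<subseteq> U" "y \<in> exterior_power j U" for g y
      using nat U that unfolding natural_transformation_def GL_def by blast
  qed
  then show "\<not> (\<exists>\<eta> :: 'u set \<Rightarrow> 'u exterior \<Rightarrow> 'u tensor.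
      natural_transformation j \<eta> \<and> nonzero_transformation j \<eta>)"
    unfolding nonzero_transformation_def by blast
qed

end
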